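(* Let $\mathcal{A}$ be an infinite sequence of positive integers, let $\mathbf{m}=\{(k_1,m_1),\dots,(k_r,m_r)\}$ be a configuration of degree $s=\gcd(m_1,\dots,m_r)>1$, and let $\varepsilon>0$. Then, for every constant $c>0$, the estimate $$\sum_{j=1}^{n}\left(r_{\mathbf{m}}(j,\mathcal{A})-c\right)=O\left(n^{1/4-\varepsilon}\right)\qquad (n\to\infty)$$ does not hold.
   Context: An infinite sequence of positive integers $\mathcal{A}$ is regarded as an infinite set of (distinct) positive integers. A configuration is a set $\mathbf{m}=\{(k_1,m_1),\dots,(k_r,m_r)\}$ with $r\ge 1$, where $0<k_1<k_2<\dots<k_r$ are positive integers and $m_1,\dots,m_r>0$ are positive integers ($m_i$ is called the multiplicity of $k_i$). The degree of $\mathbf{m}$ is $\gcd(m_1,\dots,m_r)$. The representation function $r_{\mathbf{m}}(n,\mathcal{A})$ is the number of different solutions of the equation $$n=k_1(a_{1,1}+\dots+a_{1,m_1})+\dots+k_r(a_{r,1}+\dots+a_{r,m_r}),\qquad a_{i,j}\in\mathcal{A},$$ where solutions are counted as ordered tuples $(a_{i,j})_{1\le i\le r,\,1\le j\le m_i}$; equivalently, $\sum_{n\ge 0} r_{\mathbf{m}}(n,\mathcal{A})z^n=\prod_{i=1}^r f_{\mathcal{A}}(z^{k_i})^{m_i}$, where $f_{\mathcal{A}}(z)=\sum_{a\in\mathcal{A}}z^a$. *)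

theory Defs
  imports Complex_Main "HOL-Library.FuncSet" "HOL-Library.Landau_Symbols"
begin

(* Injectivity of fst says that the k_i are pairwise distinct; since m is a finite set,
   enumerating it as k_1 < ... < k_r is then only a matter of notation. *)
definition configuration :: "(nat \<times> nat) set \<Rightarrow> bool" where
  "configuration m \<longleftrightarrow> finite m \<and> m \<noteq> {} \<and> inj_on fst m \<and> (\<forall>(k, l)\<in>m. 0 < k \<and> 0 < l)"

definition config_degree :: "(nat \<times> nat) set \<Rightarrow> nat" where
  "config_degree m = Gcd (snd ` m)"

(* The variable a_{i,j} is the value of the tuple at the index (k_i, j); this is unambiguous
   because the k_i are distinct. *)
definition config_index :: "(nat \<times> nat) set \<Rightarrow> (nat \<times> nat) set" where
  "config_index m = (\<Union>(k, l)\<in>m. {k} \<times> {1..l})"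

(* Ordered tuples with entries in A are the extensional functions from the index set to A,
   so each tuple is counted exactly once. *)
definition solutions :: "(nat \<times> nat) set \<Rightarrow> nat \<Rightarrow> nat set \<Rightarrow> (nat \<times> nat \<Rightarrow> nat) set" where
  "solutions m n A =
     {a \<in> config_index m \<rightarrow>\<^sub>E A. n = (\<Sum>(k, l)\<in>m. k * (\<Sum>j=1..l. a (k, j)))}"

definition rep_fun :: "(nat \<times> nat) set \<Rightarrow> nat \<Rightarrow> nat set \<Rightarrow> nat" where
  "rep_fun m n A = card (solutions m n A)"

(* The cardinality in rep_fun is never that of an infinite set. *)
lemma finite_solutions:
  assumes "configuration m"
  shows "finite (solutions m n A)"
proof (rule finite_subset)
  have fin: "finite m" and pos: "\<And>k l. (k, l) \<in> m \<Longrightarrow> 0 < k"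
    using assms by (auto simp: configuration_def)
  show "finite (config_index m \<rightarrow>\<^sub>E {..n})"
    using fin by (intro finite_PiE) (auto simp: config_index_def)
  show "solutions m n A \<subseteq> config_index m \<rightarrow>\<^sub>E {..n}"
  proof
    fix a assume a: "a \<in> solutions m n A"
    have "a (k, j) \<le> n" if kl: "(k, l) \<in> m" and j: "j \<in> {1..l}" for k l j
    proof -
      have "a (k, j) \<le> (\<Sum>j=1..l. a (k, j))"
        using j by (intro member_le_sum) auto
      also have "\<dots> \<le> k * (\<Sum>j=1..l. a (k, j))"
        using pos[OF kl] by simp
      also have "\<dots> \<le> (\<Sum>(k, l)\<in>m. k * (\<Sum>j=1..l. a (k, j)))"
        using member_le_sum[OF kl, of "\<lambda>(k, l). k * (\<Sum>j=1..l. a (k, j))"] fin by simp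
      also have "\<dots> = n"
        using a by (simp add: solutions_def)
      finally show ?thesis .
    qed
    then have "a i \<le> n" if "i \<in> config_index m" for i
      using that unfolding config_index_def by blast
    moreover have "a \<in> extensional (config_index m)"
      using a by (simp add: solutions_def PiE_iff)
    ultimately show "a \<in> config_index m \<rightarrow>\<^sub>E {..n}"
      by (simp add: PiE_iff)
  qed
qed

end

theory Submission
  imports Defs "HOL-Analysis.Analysis" "HOL-Real_Asymp.Real_Asymp"
begin

text \<open>Let \<open>f\<close> be the generating function of \<open>A\<close> and \<open>s\<close> the degree of the configuration. Since \<open>s\<close> divides all
multiplicities, the generating function \<open>G\<close> of the representation function is \<open>g ^ s\<close>, where \<open>g\<close> is the
product of the \<open>f(z ^ k) ^ (l / s)\<close> over the pairs \<open>(k, l)\<close> of the configuration. The series \<open>g\<close>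
converges in the unit disc and its coefficients are natural numbers, so the theorem
is an instance of an Erdos-Fuchs theorem for \<open>s\<close>-th powers of such series (\<open>erdos_fuchs_power\<close>).

Suppose that the partial sums of the coefficients of \<open>G\<close> are \<open>c * n + E n\<close> with \<open>E n\<close> of order
\<open>n powr (1/4 - \<delta>)\<close>. Then \<open>G = c * z / (1 - z) + (1 - z) * H\<close>, where \<open>H\<close> has the coefficients \<open>E n\<close>
(\<open>error_fps\<close>). Following Newman's proof for squares, let \<open>S = 1 + z + ... + z ^ (N - 1)\<close> and compare two
bounds for the mean of \<open>\<bar>S\<bar>\<^sup>2 * \<bar>G\<bar>\<close> over the circle \<open>\<bar>z\<bar>\<^sup>2 = 1 - 1 / n\<close>; all means are evaluated by
Parseval's identity (\<open>parseval_circle_mean\<close>).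

From below (\<open>circle_mean_power_lower\<close>): the coefficients \<open>d\<close> of \<open>S * g\<close> are natural numbers, so that
\<open>d \<le> d\<^sup>2\<close>, and the mean of \<open>\<bar>S * g\<bar>\<^sup>2\<close> is at least the value of \<open>S * g\<close> at \<open>1 - 1 / n\<close>, which has the order
\<open>N * n powr (1 / s)\<close>. As the mean of \<open>\<bar>S\<bar>\<^sup>2\<close> is at most \<open>N\<close>, convexity turns this into a lower bound of
order \<open>N * n powr (1/2)\<close> for the mean of \<open>\<bar>S\<bar>\<^sup>2 * \<bar>g\<bar> ^ s\<close>. The exponent \<open>s\<close> has disappeared.

From above (\<open>circle_mean_upper\<close>): the pole contributes at most a constant times \<open>N\<^sup>2 * ln n\<close>, because the mean
of \<open>1 / \<bar>1 - z\<bar>\<close> is of order \<open>ln n\<close>. In the other part \<open>\<bar>S\<bar> * \<bar>1 - z\<bar> = \<bar>1 - z ^ N\<bar> \<le> 2\<close>, and the mean of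
\<open>\<bar>S\<bar> * \<bar>H\<bar>\<close> is at most of order \<open>N powr (1/2) * n powr (3/4 - \<delta>)\<close>.

For \<open>N\<close> about \<open>n powr (1/2 - \<delta>)\<close> both upper terms are of smaller order than the lower bound, a
contradiction (\<open>erdos_fuchs_inequality\<close>, \<open>erdos_fuchs_error_terms_smaller\<close>).\<close>

section \<open>Means over circles and Parseval's identity\<close>

definition circle_mean :: "real \<Rightarrow> (complex \<Rightarrow> real) \<Rightarrow> real" where
  "circle_mean r \<phi> = integral {0..2 * pi} (\<lambda>t. \<phi> (of_real r * cis t)) / (2 * pi)"

lemma circle_mean_has_integral:
  assumes "r \<ge> 0" "continuous_on (sphere 0 r) \<phi>"
  shows "((\<lambda>t. \<phi> (of_real r * cis t)) has_integral 2 * pi * circle_mean r \<phi>) {0..2 * pi}"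
proof -
  have "continuous_on {0..2 * pi} (\<lambda>t. \<phi> (of_real r * cis t))"
    by (rule continuous_on_compose2[OF assms(2)])
       (use assms(1) in \<open>auto intro!: continuous_intros simp: norm_mult\<close>)
  then show ?thesis
    using integrable_continuous_real integrable_integral by (fastforce simp: circle_mean_def)
qed

lemma circle_mean_unique:
  assumes "((\<lambda>t. \<phi> (of_real r * cis t)) has_integral 2 * pi * y) {0..2 * pi}"
  shows "circle_mean r \<phi> = y"
  using integral_unique[OF assms] by (simp add: circle_mean_def)

lemma circle_mean_mono:
  assumes "r \<ge> 0" "continuous_on (sphere 0 r) \<phi>" "continuous_on (sphere 0 r) \<psi>"
    and "\<And>z. cmod z = r \<Longrightarrow> \<phi> z \<le> \<psi> z"
  shows "circle_mean r \<phi> \<le> circle_mean r \<psi>"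
proof -
  have "2 * pi * circle_mean r \<phi> \<le> 2 * pi * circle_mean r \<psi>"
    using assms(1,4)
    by (intro has_integral_le[OF circle_mean_has_integral circle_mean_has_integral] assms)
       (simp add: norm_mult)
  then show ?thesis by simp
qed

lemma circle_mean_add:
  assumes "r \<ge> 0" "continuous_on (sphere 0 r) \<phi>" "continuous_on (sphere 0 r) \<psi>"
  shows "circle_mean r (\<lambda>z. \<phi> z + \<psi> z) = circle_mean r \<phi> + circle_mean r \<psi>"
  using has_integral_add[OF circle_mean_has_integral circle_mean_has_integral, OF assms(1,2,1,3)]
  by (intro circle_mean_unique) (simp add: algebra_simps)

lemma circle_mean_cmult: "circle_mean r (\<lambda>z. a * \<phi> z) = a * circle_mean r \<phi>"
  by (simp add: circle_mean_def)

lemma circle_mean_const: "circle_mean r (\<lambda>z. a) = a"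
  by (simp add: circle_mean_def)

lemma has_integral_cis_nonzero:
  fixes d :: int
  assumes "d \<noteq> 0"
  shows "((\<lambda>t. cis (of_int d * t)) has_integral 0) {0..2 * pi}"
proof -
  have "((\<lambda>t. cis (of_int d * t)) has_integral
          (cis (of_int d * (2 * pi)) / (\<i> * of_int d) - cis (of_int d * 0) / (\<i> * of_int d))) {0..2 * pi}"
  proof (intro fundamental_theorem_of_calculus)
    fix t :: real
    have "((\<lambda>z. exp (\<i> * of_int d * z) / (\<i> * of_int d)) has_field_derivative
            exp (\<i> * of_int d * of_real t)) (at (of_real t))"
      using assms by (auto intro!: derivative_eq_intros)
    from has_vector_derivative_real_field[OF this]
    show "((\<lambda>t. cis (of_int d * t) / (\<i> * of_int d)) has_vector_derivative cis (of_int d * t))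
            (at t within {0..2 * pi})"
      by (simp add: cis_conv_exp mult_ac)
  qed auto
  moreover have "cis (of_int d * (2 * pi)) = 1"
    using cis_multiple_2pi[of "of_int d"] by (simp add: mult_ac)
  ultimately show ?thesis by simp
qed

lemma circle_mean_cross_term:
  assumes "k \<noteq> n"
  shows "circle_mean r (\<lambda>z. Re (b * z ^ k * cnj (a * z ^ n))) = 0"
proof (rule circle_mean_unique)
  have "((\<lambda>t. cis (of_int (int k - int n) * t)) has_integral 0) {0..2 * pi}"
    by (rule has_integral_cis_nonzero) (use assms in simp)
  from has_integral_Re[OF has_integral_mult_right[OF this, of "b * cnj a * of_real r ^ (k + n)"]]
  have "((\<lambda>t. Re (b * cnj a * of_real r ^ (k + n) * cis (of_int (int k - int n) * t))) has_integral 0) {0..2 * pi}"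
    by simp
  also have "(\<lambda>t. Re (b * cnj a * of_real r ^ (k + n) * cis (of_int (int k - int n) * t)))
    = (\<lambda>t. Re (b * (of_real r * cis t) ^ k * cnj (a * (of_real r * cis t) ^ n)))"
  proof
    fix t
    have "cis (of_int (int k - int n) * t) = cis t ^ k * cnj (cis t) ^ n"
    proof -
      have "cis t ^ k * cnj (cis t) ^ n = cis (real k * t) * cis (real n * (- t))"
        by (simp only: cis_cnj Complex.DeMoivre)
      then show ?thesis by (simp add: cis_mult algebra_simps)
    qed
    then show "Re (b * cnj a * of_real r ^ (k + n) * cis (of_int (int k - int n) * t)) =
       Re (b * (of_real r * cis t) ^ k * cnj (a * (of_real r * cis t) ^ n))"
      by (simp add: power_mult_distrib power_add mult_ac)
  qed
  finally show "((\<lambda>t. Re (b * (of_real r * cis t) ^ k * cnj (a * (of_real r * cis t) ^ n))) has_integral 2 * pi * 0) {0..2 * pi}"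
    by simp
qed

lemma circle_mean_sum:
  assumes "r \<ge> 0" "\<And>i. i \<in> I \<Longrightarrow> continuous_on (sphere 0 r) (\<phi> i)"
  shows "circle_mean r (\<lambda>z. \<Sum>i\<in>I. \<phi> i z) = (\<Sum>i\<in>I. circle_mean r (\<phi> i))"
  using assms(2)
proof (induction I rule: infinite_finite_induct)
  case (insert i I)
  then show ?case using assms(1) by (simp add: circle_mean_add continuous_on_sum)
qed (auto simp: circle_mean_const)

lemma cmod_add_power2: "(cmod (u + v))\<^sup>2 = (cmod u)\<^sup>2 + (cmod v)\<^sup>2 + 2 * Re (u * cnj v)"
  unfolding cmod_power2 by (simp add: power2_eq_square algebra_simps)

text \<open>Orthogonality of the monomials: multiplying out \<open>(cmod (P + a * z ^ k))\<^sup>2\<close> leaves only cross terms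
between different powers of \<open>z\<close>, and these have mean zero.\<close>

lemma circle_mean_poly:
  fixes a :: "nat \<Rightarrow> complex"
  assumes "r \<ge> 0"
  shows "circle_mean r (\<lambda>z. (cmod (\<Sum>n<k. a n * z ^ n))\<^sup>2) = (\<Sum>n<k. (cmod (a n))\<^sup>2 * r ^ (2 * n))"
proof (induction k)
  case (Suc k)
  define P where "P = (\<lambda>z. \<Sum>n<k. a n * z ^ n)"
  have eq: "(cmod (P z + a k * z ^ k))\<^sup>2 =
     ((cmod (P z))\<^sup>2 + (cmod (a k * z ^ k))\<^sup>2) + 2 * (\<Sum>n<k. Re (a n * z ^ n * cnj (a k * z ^ k)))" for z
  proof -
    have "(cmod (P z + a k * z ^ k))\<^sup>2 = (cmod (P z))\<^sup>2 + (cmod (a k * z ^ k))\<^sup>2 + 2 * Re (P z * cnj (a k * z ^ k))"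
      by (rule cmod_add_power2)
    also have "Re (P z * cnj (a k * z ^ k)) = (\<Sum>n<k. Re (a n * z ^ n * cnj (a k * z ^ k)))"
      by (simp add: P_def sum_distrib_right)
    finally show ?thesis .
  qed
  have cP: "continuous_on X P" for X
    unfolding P_def by (intro continuous_intros)
  have const: "circle_mean r (\<lambda>z. (cmod (a k * z ^ k))\<^sup>2) = (cmod (a k))\<^sup>2 * r ^ (2 * k)"
    using assms by (simp add: circle_mean_def norm_mult norm_power power_mult_distrib power_mult mult.commute[of 2 k])
  have "circle_mean r (\<lambda>z. (cmod (P z + a k * z ^ k))\<^sup>2) =
     (circle_mean r (\<lambda>z. (cmod (P z))\<^sup>2) + circle_mean r (\<lambda>z. (cmod (a k * z ^ k))\<^sup>2))
       + 2 * (\<Sum>n<k. circle_mean r (\<lambda>z. Re (a n * z ^ n * cnj (a k * z ^ k))))"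
    unfolding eq
    by (subst circle_mean_add[OF assms], (intro continuous_intros cP)+)
       (subst circle_mean_add[OF assms] circle_mean_cmult circle_mean_sum[OF assms],
        (intro continuous_intros cP)+, simp only: circle_mean_cmult,
        subst circle_mean_sum[OF assms], (intro continuous_intros cP)+, rule refl)
  also have "(\<Sum>n<k. circle_mean r (\<lambda>z. Re (a n * z ^ n * cnj (a k * z ^ k)))) = 0"
    by (intro sum.neutral ballI circle_mean_cross_term) simp
  finally show ?case using Suc.IH const by (simp add: P_def)
qed (simp add: circle_mean_const)

lemma eval_fps_continuous_on_sphere [continuous_intros]:
  assumes "ereal r < fps_conv_radius F"
  shows "continuous_on (sphere 0 r) (eval_fps (F :: complex fps))"
  by (rule continuous_on_subset[OF continuous_on_eval_fps]) (use assms in \<open>auto simp: in_eball_iff\<close>)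

text \<open>On a circle inside the disc of convergence the partial sums converge uniformly, so the identity for
polynomials passes to the limit.\<close>

theorem parseval_circle_mean:
  fixes F :: "complex fps"
  assumes "r \<ge> 0" "ereal r < fps_conv_radius F"
  shows "(\<lambda>n. (cmod (fps_nth F n))\<^sup>2 * r ^ (2 * n)) sums circle_mean r (\<lambda>z. (cmod (eval_fps F z))\<^sup>2)"
proof -
  define a where "a = fps_nth F"
  have summ: "summable (\<lambda>n. cmod (a n) * r ^ n)"
    using norm_summable_fps[of "of_real r" F] assms by (simp add: a_def norm_mult norm_power)
  have lim: "uniform_limit (sphere 0 r) (\<lambda>k z. \<Sum>n<k. a n * z ^ n) (eval_fps F) sequentially"
    unfolding eval_fps_def a_def[symmetric]
    by (rule Weierstrass_m_test[OF _ summ]) (simp add: norm_mult norm_power)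
  have "bounded (eval_fps F ` sphere 0 r)"
    by (intro compact_imp_bounded compact_continuous_image continuous_intros assms compact_sphere)
  then have bdd: "bounded ((\<lambda>z. cmod (eval_fps F z)) ` sphere 0 r)"
    by (auto simp: bounded_iff)
  have lim2: "uniform_limit (sphere 0 r) (\<lambda>k z. (cmod (\<Sum>n<k. a n * z ^ n))\<^sup>2) (\<lambda>z. (cmod (eval_fps F z))\<^sup>2) sequentially"
    unfolding power2_eq_square
    by (intro uniform_lim_mult uniform_limit_norm lim bdd)
  have lim3: "uniform_limit {0..2*pi} (\<lambda>k t. (cmod (\<Sum>n<k. a n * (of_real r * cis t) ^ n))\<^sup>2)
                 (\<lambda>t. (cmod (eval_fps F (of_real r * cis t)))\<^sup>2) sequentially"
    by (rule uniform_limit_compose'[OF lim2]) (use assms in \<open>auto simp: norm_mult\<close>)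
  obtain I J where IJ: "\<And>k. ((\<lambda>t. (cmod (\<Sum>n<k. a n * (of_real r * cis t) ^ n))\<^sup>2) has_integral I k) {0..2*pi}"
     "((\<lambda>t. (cmod (eval_fps F (of_real r * cis t)))\<^sup>2) has_integral J) {0..2*pi}" "I \<longlonglongrightarrow> J"
    by (rule uniform_limit_integral[OF lim3]) (auto intro!: continuous_intros)
  have I: "I k / (2 * pi) = (\<Sum>n<k. (cmod (a n))\<^sup>2 * r ^ (2 * n))" for k
    using integral_unique[OF IJ(1)[of k]] circle_mean_poly[OF assms(1), of a k]
    by (simp add: circle_mean_def)
  have J: "J / (2 * pi) = circle_mean r (\<lambda>z. (cmod (eval_fps F z))\<^sup>2)"
    using integral_unique[OF IJ(2)] by (simp add: circle_mean_def)
  have "(\<lambda>k. I k / (2 * pi)) \<longlonglongrightarrow> J / (2 * pi)"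
    by (intro tendsto_intros IJ) auto
  then show ?thesis unfolding sums_def I J a_def .
qed

section \<open>Power series with natural number coefficients\<close>

lemma conv_radius_ge_1_bounded:
  fixes F :: "complex fps"
  assumes "\<And>n. cmod (fps_nth F n) \<le> 1"
  shows "fps_conv_radius F \<ge> 1"
  unfolding fps_conv_radius_def
proof (rule conv_radius_geI_ex)
  fix r :: real assume r: "0 < r" "ereal r < 1"
  have "summable (\<lambda>n. fps_nth F n * of_real r ^ n)"
  proof (rule summable_comparison_test)
    show "\<exists>N. \<forall>n\<ge>N. norm (fps_nth F n * of_real r ^ n) \<le> r ^ n"
      using assms r by (auto simp: norm_mult norm_power intro!: mult_left_le_one_le)
  qed (use r in \<open>auto intro!: summable_geometric\<close>)
  then show "\<exists>z. norm z = r \<and> summable (\<lambda>n. fps_nth F n * z ^ n)"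
    using r by (intro exI[of _ "of_real r"]) auto
qed

lemma less_conv_radius:
  fixes F :: "complex fps"
  shows "fps_conv_radius F \<ge> 1 \<Longrightarrow> x < 1 \<Longrightarrow> ereal x < fps_conv_radius F"
  by (meson ereal_less(3) less_le_trans)

lemma Nats_fps_mult:
  fixes f g :: "complex fps"
  assumes "\<And>n. fps_nth f n \<in> \<nat>" "\<And>n. fps_nth g n \<in> \<nat>"
  shows "fps_nth (f * g) n \<in> \<nat>"
proof -
  have "(\<Sum>i\<in>I. fps_nth f i * fps_nth g (n - i)) \<in> \<nat>" for I
    by (induction I rule: infinite_finite_induct) (use assms in auto)
  then show ?thesis by (simp add: fps_mult_nth)
qed

lemma eval_fps_Nats:
  fixes g :: "complex fps"
  assumes "fps_conv_radius g \<ge> 1" "\<And>n. fps_nth g n \<in> \<nat>" "0 \<le> x" "x < 1"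
  obtains q where "q \<ge> 0" "eval_fps g (of_real x) = of_real q"
proof -
  have nn: "fps_nth g n = of_real (cmod (fps_nth g n))" for n
    using assms(2)[of n] by (auto elim: Nats_cases)
  have sm: "(\<lambda>n. fps_nth g n * of_real x ^ n) sums eval_fps g (of_real x)"
    by (rule sums_eval_fps) (use assms less_conv_radius in auto)
  have eq: "(\<lambda>n. fps_nth g n * of_real x ^ n) = (\<lambda>n. of_real (cmod (fps_nth g n) * x ^ n))"
    by (subst nn) simp
  from sm have "summable (\<lambda>n. complex_of_real (cmod (fps_nth g n) * x ^ n))"
    unfolding eq by (rule sums_summable)
  then have summ: "summable (\<lambda>n. cmod (fps_nth g n) * x ^ n)"
    by (rule summable_of_real_iff[THEN iffD1])
  show ?thesis
  proof
    show "(\<Sum>n. cmod (fps_nth g n) * x ^ n) \<ge> 0"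
      by (rule suminf_nonneg[OF summ]) (use assms in auto)
    show "eval_fps g (of_real x) = of_real (\<Sum>n. cmod (fps_nth g n) * x ^ n)"
      using sm sums_of_real[OF summable_sums[OF summ]] unfolding eq by (metis sums_unique2)
  qed
qed

text \<open>This is where integrality enters: a natural number is at most its square, so by Parseval's identity
the mean square of \<open>F\<close> on the circle of radius \<open>r\<close> is at least the value of \<open>F\<close> at \<open>r\<^sup>2\<close>.
For real coefficients that are not integers no such bound holds.\<close>

lemma eval_le_circle_mean_Nats:
  fixes F :: "complex fps"
  assumes "r \<ge> 0" "r < 1" "fps_conv_radius F \<ge> 1" "\<And>n. fps_nth F n \<in> \<nat>"
  shows "Re (eval_fps F (of_real (r\<^sup>2))) \<le> circle_mean r (\<lambda>z. (cmod (eval_fps F z))\<^sup>2)"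
proof (rule sums_le)
  have r2: "r\<^sup>2 < 1" using assms by (simp add: power_less_one_iff abs_square_less_1)
  have conv: "ereal x < fps_conv_radius F" if "x < 1" for x
    using that assms(3) less_conv_radius by blast
  show "(\<lambda>n. (cmod (fps_nth F n))\<^sup>2 * r ^ (2 * n)) sums circle_mean r (\<lambda>z. (cmod (eval_fps F z))\<^sup>2)"
    by (rule parseval_circle_mean) (use assms conv in auto)
  show "(\<lambda>n. Re (fps_nth F n * of_real (r\<^sup>2) ^ n)) sums Re (eval_fps F (of_real (r\<^sup>2)))"
    by (intro sums_Re sums_eval_fps) (use r2 conv in \<open>auto simp: norm_power\<close>)
  show "Re (fps_nth F n * of_real (r\<^sup>2) ^ n) \<le> (cmod (fps_nth F n))\<^sup>2 * r ^ (2 * n)" for n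
  proof -
    obtain a :: nat where a: "fps_nth F n = of_nat a" using assms(4)[of n] by (auto elim: Nats_cases)
    have "real a \<le> (real a)\<^sup>2" by (metis of_nat_le_iff of_nat_power power2_nat_le_imp_le order_refl)
    then have "real a * r ^ (2 * n) \<le> (real a)\<^sup>2 * r ^ (2 * n)"
      using assms(1) by (intro mult_right_mono) auto
    then show ?thesis by (simp add: a flip: power_mult of_real_power)
  qed
qed

section \<open>Mean values of the auxiliary functions\<close>

abbreviation geom_fps :: "nat \<Rightarrow> complex fps" where
  "geom_fps N \<equiv> (\<Sum>k<N. fps_X ^ k)"

lemma eval_geom_fps: "eval_fps (geom_fps N) z = (\<Sum>k<N. z ^ k)"
proof -
  have "geom_fps N = fps_of_poly (\<Sum>k<N. monom 1 k)"
    by (simp add: fps_of_poly_sum fps_of_poly_monom)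
  then show ?thesis by (simp add: poly_sum poly_monom)
qed

lemma fps_conv_radius_geom_fps: "fps_conv_radius (geom_fps N) = \<infinity>"
proof -
  have "geom_fps N = fps_of_poly (\<Sum>k<N. monom 1 k)"
    by (simp add: fps_of_poly_sum fps_of_poly_monom)
  then show ?thesis by simp
qed

lemma fps_nth_geom_fps: "fps_nth (geom_fps N) n = (if n < N then 1 else 0)"
  by (simp add: fps_sum_nth fps_X_power_nth)

lemma circle_mean_geom_le:
  assumes "0 \<le> r" "r < 1"
  shows "circle_mean r (\<lambda>z. (cmod (eval_fps (geom_fps N) z))\<^sup>2) \<le> N"
proof -
  have "(\<lambda>n. (cmod (fps_nth (geom_fps N) n))\<^sup>2 * r ^ (2 * n)) sums
          circle_mean r (\<lambda>z. (cmod (eval_fps (geom_fps N) z))\<^sup>2)"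
    by (rule parseval_circle_mean) (use assms in \<open>auto simp: fps_conv_radius_geom_fps\<close>)
  moreover have "(\<lambda>n. (cmod (fps_nth (geom_fps N) n))\<^sup>2 * r ^ (2 * n)) sums (\<Sum>n<N. r ^ (2 * n))"
    using sums_finite[of "{..<N}" "\<lambda>n. (cmod (fps_nth (geom_fps N) n))\<^sup>2 * r ^ (2 * n)"]
    by (simp add: fps_nth_geom_fps)
  ultimately have "circle_mean r (\<lambda>z. (cmod (eval_fps (geom_fps N) z))\<^sup>2) = (\<Sum>n<N. r ^ (2 * n))"
    by (rule sums_unique2)
  also have "\<dots> \<le> (\<Sum>n<N. 1)"
    using assms by (intro sum_mono power_le_one) auto
  finally show ?thesis by simp
qed

text \<open>The binomial series of \<open>(1 - z) powr (-1/2)\<close>. Its squared modulus is \<open>1 / cmod (1 - z)\<close>, so that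
Parseval's identity bounds the mean of \<open>1 / cmod (1 - z)\<close> without an estimate of an integral.\<close>

definition inv_sqrt_fps :: "complex fps" where
  "inv_sqrt_fps = Abs_fps (\<lambda>n. (-1) ^ n * ((-1/2) gchoose n))"

lemma inv_sqrt_fps_coeff_le: "(cmod (fps_nth inv_sqrt_fps n))\<^sup>2 \<le> 1 / (n + 1)"
proof (induction n)
  case (Suc n)
  define b where "b = (\<lambda>n. (cmod (fps_nth inv_sqrt_fps n))\<^sup>2)"
  have "fps_nth inv_sqrt_fps (Suc n) = fps_nth inv_sqrt_fps n * of_real ((2 * n + 1) / (2 * n + 2))"
    by (simp add: inv_sqrt_fps_def gbinomial_Suc_rec field_simps)
  then have "b (Suc n) = b n * ((2 * n + 1) / (2 * n + 2))\<^sup>2"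
    unfolding b_def by (simp only: norm_mult power_mult_distrib norm_of_real power2_abs)
  also have "\<dots> \<le> 1 / (n + 1) * ((2 * n + 1) / (2 * n + 2))\<^sup>2"
    using Suc.IH by (intro mult_right_mono) (auto simp: b_def add.commute)
  also have "\<dots> \<le> 1 / (Suc n + 1)"
    by (simp add: divide_simps power2_eq_square) (simp add: algebra_simps)
  finally show ?case by (simp add: b_def)
qed (simp add: inv_sqrt_fps_def)

lemma cmod_eval_inv_sqrt_fps:
  assumes "cmod z < 1"
  shows "(cmod (eval_fps inv_sqrt_fps z))\<^sup>2 = 1 / cmod (1 - z)"
proof -
  have "(\<lambda>n. fps_nth inv_sqrt_fps n * z ^ n) sums (1 + - z) powr (-1/2)"
    using gen_binomial_complex[of "-z" "-1/2"] assms
    by (simp add: inv_sqrt_fps_def power_minus[of z] mult_ac)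
  then have eq: "eval_fps inv_sqrt_fps z = (1 - z) powr (-1/2)"
    by (simp add: eval_fps_def sums_iff)
  have "1 - z \<noteq> 0" using assms by auto
  then have "((1 - z) powr (-1/2))\<^sup>2 = 1 / (1 - z)"
    by (simp add: power2_eq_square powr_minus_divide flip: powr_add)
  then show ?thesis unfolding eq by (simp flip: norm_power add: norm_divide)
qed

text \<open>The squared coefficients of \<open>(1 - z) powr (-1/2)\<close> are at most \<open>1 / (n + 1)\<close>, which turns the
Parseval series into the logarithmic series.\<close>

lemma circle_mean_inverse_le:
  assumes "0 < r" "r < 1"
  shows "circle_mean r (\<lambda>z. 1 / cmod (1 - z)) \<le> - ln (1 - r\<^sup>2) / r\<^sup>2"
proof -
  have "fps_conv_radius inv_sqrt_fps \<ge> 1"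
  proof (rule conv_radius_ge_1_bounded)
    fix n
    have "(cmod (fps_nth inv_sqrt_fps n))\<^sup>2 \<le> 1\<^sup>2"
      using inv_sqrt_fps_coeff_le[of n] by (rule order_trans) simp
    then show "cmod (fps_nth inv_sqrt_fps n) \<le> 1" by (rule power2_le_imp_le) simp
  qed
  then have conv: "ereal r < fps_conv_radius inv_sqrt_fps"
    using assms less_conv_radius by blast
  define x where "x = r\<^sup>2"
  have x: "0 < x" "x < 1" using assms by (auto simp: x_def power_less_one_iff abs_square_less_1)
  have "circle_mean r (\<lambda>z. 1 / cmod (1 - z)) = circle_mean r (\<lambda>z. (cmod (eval_fps inv_sqrt_fps z))\<^sup>2)"
    unfolding circle_mean_def using assms by (simp add: cmod_eval_inv_sqrt_fps norm_mult)
  also have "\<dots> \<le> - ln (1 - x) / x"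
  proof (rule sums_le)
    show "(\<lambda>n. (cmod (fps_nth inv_sqrt_fps n))\<^sup>2 * r ^ (2 * n)) sums
            circle_mean r (\<lambda>z. (cmod (eval_fps inv_sqrt_fps z))\<^sup>2)"
      by (rule parseval_circle_mean) (use assms conv in auto)
    have "(\<lambda>n. - ((- (- x)) ^ n) / of_nat n) sums ln (1 + (-x))"
      by (rule ln_series') (use x in auto)
    then have "(\<lambda>n. (- 1 / x) * (- ((- (- x)) ^ n) / of_nat n)) sums ((- 1 / x) * ln (1 - x))"
      by (intro sums_mult) simp
    moreover have "(\<lambda>n. (- 1 / x) * (- ((- (- x)) ^ n) / of_nat n)) = (\<lambda>n. x ^ n / n / x)"
      by (simp add: mult.commute)
    ultimately have "(\<lambda>n. x ^ n / n / x) sums ((- 1 / x) * ln (1 - x))"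
      by (simp only:)
    then have "(\<lambda>n. x ^ Suc n / Suc n / x) sums ((- 1 / x) * ln (1 - x))"
      using sums_Suc_iff[of "\<lambda>n. x ^ n / n / x" "(- 1 / x) * ln (1 - x)"] by simp
    then show "(\<lambda>n. x ^ n / (n + 1)) sums (- ln (1 - x) / x)"
      using x by (simp add: add.commute)
    show "(cmod (fps_nth inv_sqrt_fps n))\<^sup>2 * r ^ (2 * n) \<le> x ^ n / (n + 1)" for n
      using mult_right_mono[OF inv_sqrt_fps_coeff_le[of n], of "x ^ n"] x
      by (simp add: x_def power_mult add.commute)
  qed
  finally show ?thesis by (simp add: x_def)
qed

text \<open>At \<open>x = 1 - 1 / n\<close> only the first \<open>n\<close> or so terms count. Writing \<open>u = (k + 1) / n\<close>, the inequality
\<open>u powr p \<le> 1 + u\<close> reduces the sum to the geometric series and its derivative.\<close>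

lemma suminf_powr_le:
  fixes x p :: real and n :: nat
  assumes "n > 0" "0 \<le> p" "p \<le> 1" and x: "x = 1 - 1 / n"
  shows "summable (\<lambda>k. (real k + 1) powr p * x ^ k)"
    and "(\<Sum>k. (real k + 1) powr p * x ^ k) \<le> 2 * real n powr (1 + p)"
proof -
  have x01: "0 \<le> x" "x < 1" using assms by auto
  have s1: "(\<lambda>k. x ^ k) sums real n"
    using geometric_sums[of x] x01 assms by simp
  have s2: "(\<lambda>k. (real k + 1) * x ^ k) sums (real n)\<^sup>2"
    using geometric_deriv_sums[of x] x01 assms by (simp add: add.commute power2_eq_square)
  have s: "(\<lambda>k. real n powr p * (x ^ k + (real k + 1) * x ^ k / n)) sums
             (real n powr p * (real n + (real n)\<^sup>2 / n))"
    by (intro sums_mult sums_add sums_divide s1 s2)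
  have le: "(real k + 1) powr p * x ^ k \<le> real n powr p * (x ^ k + (real k + 1) * x ^ k / n)" for k
  proof -
    define u where "u = (real k + 1) / n"
    have "u powr p \<le> 1 + u"
    proof (cases "u \<le> 1")
      case True
      then have "u powr p \<le> 1" using assms by (intro powr_le1) (auto simp: u_def)
      then show ?thesis by (simp add: u_def add_increasing2)
    next
      case False
      then have "u powr p \<le> u powr 1" using assms by (intro powr_mono) auto
      then show ?thesis using False by simp
    qed
    moreover have "(real k + 1) powr p = real n powr p * u powr p"
      using assms by (simp add: u_def powr_divide)
    ultimately have "(real k + 1) powr p \<le> real n powr p * (1 + u)"
      by (simp add: mult_left_mono)
    then have "(real k + 1) powr p * x ^ k \<le> real n powr p * (1 + u) * x ^ k"
      using x01 by (intro mult_right_mono) auto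
    then show ?thesis by (simp add: u_def algebra_simps)
  qed
  show summ: "summable (\<lambda>k. (real k + 1) powr p * x ^ k)"
    by (rule summable_comparison_test[OF _ sums_summable[OF s]]) (use le x01 in auto)
  have "(\<Sum>k. (real k + 1) powr p * x ^ k) \<le> real n powr p * (real n + (real n)\<^sup>2 / n)"
    by (rule sums_le[OF le summable_sums[OF summ] s])
  also have "\<dots> = 2 * real n powr (1 + p)"
    using assms by (simp add: powr_add power2_eq_square)
  finally show "(\<Sum>k. (real k + 1) powr p * x ^ k) \<le> 2 * real n powr (1 + p)" .
qed

section \<open>The lower bound\<close>

text \<open>A substitute for Hoelder's inequality between the exponents \<open>2\<close> and \<open>s\<close>: integrated against a weight,
it bounds the mean of \<open>t\<^sup>2\<close> by that of \<open>t ^ s\<close> up to a free parameter \<open>B\<close>, which is chosen afterwards.\<close>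

lemma square_times_power_le:
  fixes B t :: real
  assumes "B \<ge> 0" "t \<ge> 0" "s \<ge> 2"
  shows "B ^ (s - 2) * t\<^sup>2 \<le> B ^ s + t ^ s"
proof (cases "t \<le> B")
  case True
  then have "B ^ (s - 2) * t\<^sup>2 \<le> B ^ (s - 2) * B\<^sup>2"
    using assms by (intro mult_left_mono power_mono) auto
  also have "\<dots> = B ^ s" using assms by (metis le_add_diff_inverse2 power_add)
  finally show ?thesis using assms by (simp add: add_increasing2)
next
  case False
  then have "B ^ (s - 2) * t\<^sup>2 \<le> t ^ (s - 2) * t\<^sup>2"
    using assms by (intro mult_right_mono power_mono) auto
  also have "\<dots> = t ^ s" using assms by (metis le_add_diff_inverse2 power_add)
  finally show ?thesis using assms by (simp add: add_increasing)
qed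

text \<open>Let \<open>S\<close> be the geometric sum with \<open>N\<close> terms and \<open>x = r\<^sup>2\<close>. The coefficients of \<open>S * g\<close> are natural
numbers, so the mean of \<open>(cmod (S * g))\<^sup>2\<close> is at least \<open>S x * g x\<close>, which is at least \<open>N / 2 * g x\<close>.
Passing from the exponent \<open>2\<close> to the exponent \<open>s\<close> of \<open>g\<close> costs \<open>B ^ s\<close> times the mean of
\<open>(cmod S)\<^sup>2\<close>, hence at most \<open>N * B ^ s\<close>, and with \<open>B = sqrt (g x) / 2\<close> this is half of what is
available. The resulting bound has the order \<open>N * sqrt (g x ^ s)\<close> for every \<open>s\<close>, so the case of
general \<open>s\<close> ends with the same inequality as that of squares.\<close>

lemma circle_mean_power_lower:
  fixes g :: "complex fps"
  assumes conv: "fps_conv_radius g \<ge> 1" and nat: "\<And>n. fps_nth g n \<in> \<nat>"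
    and r: "0 \<le> r" "r < 1" and s: "s \<ge> 2" and N: "(r\<^sup>2) ^ N \<ge> 1 / 2"
  shows "N * sqrt (Re (eval_fps (g ^ s) (of_real (r\<^sup>2)))) / 2 ^ s
           \<le> circle_mean r (\<lambda>z. (cmod (eval_fps (geom_fps N) z))\<^sup>2 * cmod (eval_fps (g ^ s) z))"
    (is "_ \<le> ?I")
proof -
  define x where "x = r\<^sup>2"
  define S where "S = eval_fps (geom_fps N)"
  have x: "0 \<le> x" "x < 1" using r by (auto simp: x_def power_less_one_iff abs_square_less_1)
  obtain q where q: "q \<ge> 0" "eval_fps g (of_real x) = of_real q"
    using eval_fps_Nats[OF conv nat x] by blast
  have eval_pow: "eval_fps (g ^ s) z = eval_fps g z ^ s" if "cmod z < 1" for z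
    by (rule eval_fps_power) (use that conv less_conv_radius in auto)
  have eval_mult: "eval_fps (geom_fps N * g) z = S z * eval_fps g z" if "cmod z < 1" for z
    unfolding S_def
    by (rule eval_fps_mult) (use that conv less_conv_radius in \<open>auto simp: fps_conv_radius_geom_fps\<close>)
  have conv': "fps_conv_radius (geom_fps N * g) \<ge> 1"
    using conv by (intro order_trans[OF _ fps_conv_radius_mult]) (simp add: fps_conv_radius_geom_fps)
  have nat': "fps_nth (geom_fps N * g) n \<in> \<nat>" for n
    by (rule Nats_fps_mult[OF _ nat]) (simp add: fps_nth_geom_fps)
  \<comment> \<open>With this choice \<open>B ^ (s - 2) * (N / 2 * q) = 2 * (N * B ^ s)\<close>, twice the loss \<open>N * B ^ s\<close>.\<close>
  define B where "B = sqrt q / 2"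
  have B: "B \<ge> 0" "q = 4 * B\<^sup>2" using q by (auto simp: B_def power_divide)
  have contS: "continuous_on (sphere 0 r) S"
    unfolding S_def by (intro continuous_intros) (simp add: fps_conv_radius_geom_fps)
  have contg: "continuous_on (sphere 0 r) (eval_fps g)"
    by (intro continuous_intros less_conv_radius conv r)
  have "N / 2 * q \<le> (\<Sum>k<N. x ^ k) * q"
  proof -
    have "1 / 2 \<le> x ^ k" if "k < N" for k
    proof -
      have "x ^ N \<le> x ^ k" using that x by (intro power_decreasing) auto
      then show ?thesis using N by (simp add: x_def)
    qed
    then have "(\<Sum>k<N. 1 / 2) \<le> (\<Sum>k<N. x ^ k)" by (intro sum_mono) auto
    then show ?thesis using q(1) by (intro mult_right_mono) auto
  qed
  also have "\<dots> = Re (eval_fps (geom_fps N * g) (of_real x))"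
    using x q by (simp add: eval_mult S_def eval_geom_fps flip: of_real_power of_real_sum)
  also have "\<dots> \<le> circle_mean r (\<lambda>z. (cmod (eval_fps (geom_fps N * g) z))\<^sup>2)"
    unfolding x_def by (rule eval_le_circle_mean_Nats[OF r conv' nat'])
  also have "\<dots> = circle_mean r (\<lambda>z. (cmod (S z * eval_fps g z))\<^sup>2)"
    unfolding circle_mean_def using r by (simp add: eval_mult norm_mult)
  finally have "B ^ (s - 2) * (N / 2 * q) \<le> B ^ (s - 2) * circle_mean r (\<lambda>z. (cmod (S z * eval_fps g z))\<^sup>2)"
    using B by (intro mult_left_mono) auto
  also have "\<dots> = circle_mean r (\<lambda>z. B ^ (s - 2) * (cmod (S z * eval_fps g z))\<^sup>2)"
    by (simp add: circle_mean_cmult)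
  also have "\<dots> \<le> circle_mean r (\<lambda>z. B ^ s * (cmod (S z))\<^sup>2 + (cmod (S z))\<^sup>2 * cmod (eval_fps g z) ^ s)"
  proof (rule circle_mean_mono[OF r(1)])
    fix z
    have "(cmod (S z))\<^sup>2 * (B ^ (s - 2) * (cmod (eval_fps g z))\<^sup>2) \<le> (cmod (S z))\<^sup>2 * (B ^ s + cmod (eval_fps g z) ^ s)"
      by (intro mult_left_mono square_times_power_le B s) auto
    then show "B ^ (s - 2) * (cmod (S z * eval_fps g z))\<^sup>2 \<le>
        B ^ s * (cmod (S z))\<^sup>2 + (cmod (S z))\<^sup>2 * cmod (eval_fps g z) ^ s"
      by (simp add: norm_mult power_mult_distrib algebra_simps)
  qed (intro continuous_intros contS contg)+
  also have "\<dots> = B ^ s * circle_mean r (\<lambda>z. (cmod (S z))\<^sup>2) + circle_mean r (\<lambda>z. (cmod (S z))\<^sup>2 * cmod (eval_fps g z) ^ s)"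
    by (subst circle_mean_add[OF r(1)]) (intro continuous_intros contS contg | simp add: circle_mean_cmult)+
  also have "circle_mean r (\<lambda>z. (cmod (S z))\<^sup>2 * cmod (eval_fps g z) ^ s) = ?I"
    unfolding circle_mean_def using r by (simp add: eval_pow norm_mult norm_power S_def)
  also have "B ^ s * circle_mean r (\<lambda>z. (cmod (S z))\<^sup>2) \<le> B ^ s * N"
    using B circle_mean_geom_le[OF r] by (intro mult_left_mono) (auto simp: S_def)
  finally have "B ^ (s - 2) * (N / 2 * q) \<le> B ^ s * N + ?I" by simp
  moreover have "B ^ (s - 2) * (N / 2 * q) = 2 * (B ^ s * N)"
  proof -
    have "B ^ s = B ^ (s - 2) * B\<^sup>2" using s by (metis le_add_diff_inverse2 power_add)
    then show ?thesis by (simp add: B(2))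
  qed
  ultimately have "B ^ s * N \<le> ?I" by linarith
  moreover have "sqrt (Re (eval_fps (g ^ s) (of_real x))) = sqrt q ^ s"
    using x q by (simp add: eval_pow real_sqrt_power flip: of_real_power)
  ultimately show ?thesis by (simp add: B_def power_divide x_def mult.commute)
qed

section \<open>The upper bound\<close>

text \<open>The pole part of \<open>G\<close> is estimated with \<open>cmod S \<le> N\<close>. In the other part the factor \<open>1 - z\<close> is absorbed
by the geometric sum, as \<open>(1 - z) * S = 1 - z ^ N\<close> is bounded by \<open>2\<close>; the product of \<open>S\<close> and \<open>H\<close> that
remains is split by the inequality of arithmetic and geometric means with weight \<open>\<mu>\<close>.\<close>

lemma circle_mean_upper:
  fixes G H :: "complex fps" and c \<mu> :: real
  assumes conv: "fps_conv_radius G \<ge> 1" "fps_conv_radius H \<ge> 1"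
    and r: "0 < r" "r < 1" and pos: "\<mu> > 0" "c \<ge> 0"
    and GH: "\<And>z. cmod z < 1 \<Longrightarrow> eval_fps G z = of_real c * z / (1 - z) + (1 - z) * eval_fps H z"
  shows "circle_mean r (\<lambda>z. (cmod (eval_fps (geom_fps N) z))\<^sup>2 * cmod (eval_fps G z))
     \<le> c * (real N)\<^sup>2 * (- ln (1 - r\<^sup>2) / r\<^sup>2) + \<mu> * N
        + circle_mean r (\<lambda>z. (cmod (eval_fps H z))\<^sup>2) / \<mu>" (is "?I \<le> _")
proof -
  define S where "S = eval_fps (geom_fps N)"
  have contS: "continuous_on (sphere 0 r) S"
    unfolding S_def by (intro continuous_intros) (simp add: fps_conv_radius_geom_fps)
  have contG: "continuous_on (sphere 0 r) (eval_fps G)" "continuous_on (sphere 0 r) (eval_fps H)"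
    by (intro continuous_intros less_conv_radius conv r)+
  have r0: "r \<ge> 0" using r by simp
  have cont1: "continuous_on (sphere 0 r) (\<lambda>z. 1 / cmod (1 - z))"
    using r by (intro continuous_intros) auto
  have "?I \<le> circle_mean r (\<lambda>z. c * (real N)\<^sup>2 * (1 / cmod (1 - z))
                 + (\<mu> * (cmod (S z))\<^sup>2 + (1 / \<mu>) * (cmod (eval_fps H z))\<^sup>2))"
    unfolding S_def[symmetric]
  proof (rule circle_mean_mono[OF r0])
    fix z assume z: "cmod z = r"
    then have z1: "1 - z \<noteq> 0" "cmod z < 1" "cmod z \<le> 1" using r by auto
    have SN: "cmod (S z) \<le> N"
    proof -
      have "cmod (S z) \<le> (\<Sum>k<N. cmod (z ^ k))"
        unfolding S_def eval_geom_fps by (rule norm_sum)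
      also have "\<dots> \<le> (\<Sum>k<N. 1)"
        using z1 by (intro sum_mono) (auto simp: norm_power power_le_one)
      finally show ?thesis by simp
    qed
    have S1: "cmod (S z) * cmod (1 - z) \<le> 2"
    proof -
      have "(1 - z) * S z = 1 - z ^ N"
        unfolding S_def eval_geom_fps by (simp add: one_diff_power_eq)
      then have "cmod (S z) * cmod (1 - z) = cmod (1 - z ^ N)"
        by (metis norm_mult mult.commute)
      also have "\<dots> \<le> 1 + cmod z ^ N"
        using norm_triangle_ineq4[of 1 "z ^ N"] by (simp add: norm_power)
      also have "\<dots> \<le> 2" using z1 by (simp add: power_le_one)
      finally show ?thesis .
    qed
    have "cmod (eval_fps G z) \<le> c / cmod (1 - z) + cmod (1 - z) * cmod (eval_fps H z)"
    proof -
      have "cmod (eval_fps G z) \<le> cmod (of_real c * z / (1 - z)) + cmod ((1 - z) * eval_fps H z)"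
        unfolding GH[OF z1(2)] by (rule norm_triangle_ineq)
      also have "cmod (of_real c * z / (1 - z)) \<le> c / cmod (1 - z)"
        using pos z1 by (auto simp: norm_mult norm_divide intro!: divide_right_mono mult_right_le_one_le)
      finally show ?thesis by (simp add: norm_mult)
    qed
    then have "(cmod (S z))\<^sup>2 * cmod (eval_fps G z)
        \<le> (cmod (S z))\<^sup>2 * (c / cmod (1 - z) + cmod (1 - z) * cmod (eval_fps H z))"
      by (intro mult_left_mono) auto
    also have "\<dots> = (cmod (S z))\<^sup>2 * (c / cmod (1 - z))
                     + (cmod (S z) * cmod (1 - z)) * (cmod (S z) * cmod (eval_fps H z))"
      by (simp add: algebra_simps power2_eq_square)
    also have "\<dots> \<le> (real N)\<^sup>2 * (c / cmod (1 - z)) + 2 * (cmod (S z) * cmod (eval_fps H z))"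
      using SN S1 pos by (intro add_mono mult_right_mono power_mono) auto
    also have "2 * (cmod (S z) * cmod (eval_fps H z)) \<le> \<mu> * (cmod (S z))\<^sup>2 + (1 / \<mu>) * (cmod (eval_fps H z))\<^sup>2"
    proof -
      have "0 \<le> (\<mu> * cmod (S z) - cmod (eval_fps H z))\<^sup>2 / \<mu>"
        using pos by simp
      also have "\<dots> = \<mu> * (cmod (S z))\<^sup>2 + (1 / \<mu>) * (cmod (eval_fps H z))\<^sup>2 - 2 * (cmod (S z) * cmod (eval_fps H z))"
        using pos by (simp add: power2_diff field_simps power2_eq_square)
      finally show ?thesis by simp
    qed
    finally show "(cmod (S z))\<^sup>2 * cmod (eval_fps G z) \<le> c * (real N)\<^sup>2 * (1 / cmod (1 - z))
                 + (\<mu> * (cmod (S z))\<^sup>2 + (1 / \<mu>) * (cmod (eval_fps H z))\<^sup>2)"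
      by (simp add: mult_ac)
  qed (intro continuous_intros contS contG cont1)+
  also have "\<dots> = c * (real N)\<^sup>2 * circle_mean r (\<lambda>z. 1 / cmod (1 - z))
       + (\<mu> * circle_mean r (\<lambda>z. (cmod (S z))\<^sup>2) + (1 / \<mu>) * circle_mean r (\<lambda>z. (cmod (eval_fps H z))\<^sup>2))"
    by (subst circle_mean_add[OF r0], (intro continuous_intros contS contG cont1)+)
       (subst circle_mean_add[OF r0], (intro continuous_intros contS contG)+, simp only: circle_mean_cmult)
  also have "\<dots> \<le> c * (real N)\<^sup>2 * (- ln (1 - r\<^sup>2) / r\<^sup>2) + (\<mu> * N
        + (1 / \<mu>) * circle_mean r (\<lambda>z. (cmod (eval_fps H z))\<^sup>2))"
    unfolding S_def using pos
    by (intro add_mono mult_left_mono circle_mean_inverse_le circle_mean_geom_le r r0) auto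
  finally show ?thesis by simp
qed

text \<open>Dividing \<open>G\<close> by \<open>1 - z\<close> sums its coefficients, and \<open>z / (1 - z)\<^sup>2\<close> has the coefficients \<open>n\<close>. Constructing
\<open>H\<close> from these products gives its radius of convergence without an estimate for \<open>E\<close>.\<close>

lemma error_fps:
  fixes G :: "complex fps" and R E :: "nat \<Rightarrow> real" and c :: real
  assumes conv: "fps_conv_radius G \<ge> 1" and R: "\<And>n. fps_nth G n = of_real (R n)"
    and E: "\<And>n. (\<Sum>j\<le>n. R j) = c * n + E n"
  obtains H where "\<And>n. fps_nth H n = of_real (E n)" "fps_conv_radius H \<ge> 1"
    "\<And>z. cmod z < 1 \<Longrightarrow> eval_fps G z = of_real c * z / (1 - z) + (1 - z) * eval_fps H z"
proof
  define J :: "complex fps" where "J = Abs_fps (\<lambda>_. 1)"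
  define H where "H = G * J - fps_const (of_real c) * (fps_X * (J * J))"
  have J: "fps_conv_radius J \<ge> 1"
    by (rule conv_radius_ge_1_bounded) (simp add: J_def)
  have XJJ: "fps_conv_radius (fps_X * (J * J)) \<ge> 1"
    using J by (intro order_trans[OF _ fps_conv_radius_mult]) (simp add: order_trans[OF _ fps_conv_radius_mult])
  have GJ: "fps_conv_radius (G * J) \<ge> 1"
    using J conv by (intro order_trans[OF _ fps_conv_radius_mult]) simp
  have cXJJ: "fps_conv_radius (fps_const (of_real c) * (fps_X * (J * J))) \<ge> 1"
    using XJJ by (intro order_trans[OF _ fps_conv_radius_mult]) simp
  show conv_H: "fps_conv_radius H \<ge> 1"
    unfolding H_def using GJ cXJJ by (intro order_trans[OF _ fps_conv_radius_diff]) simp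
  show "fps_nth H n = of_real (E n)" for n
  proof -
    have "fps_nth (G * J) n = of_real (\<Sum>j\<le>n. R j)"
      by (simp add: fps_mult_nth J_def R atLeast0AtMost)
    moreover have "fps_nth (fps_X * (J * J)) n = of_nat n"
      by (simp add: fps_X_mult_nth) (simp add: fps_mult_nth J_def)
    ultimately show ?thesis by (simp add: H_def E)
  qed
  fix z :: complex assume z: "cmod z < 1"
  have less: "cmod z < fps_conv_radius F" if "fps_conv_radius F \<ge> 1" for F :: "complex fps"
    using that z less_conv_radius by blast
  have evJ: "eval_fps J z = 1 / (1 - z)"
    using geometric_sums[of z] z by (simp add: J_def eval_fps_def sums_iff)
  have JJ: "fps_conv_radius (J * J) \<ge> 1"
    using J by (intro order_trans[OF _ fps_conv_radius_mult]) simp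
  have "eval_fps H z = eval_fps G z / (1 - z) - of_real c * (z * (1 / (1 - z) * (1 / (1 - z))))"
    unfolding H_def
    by (simp add: eval_fps_diff eval_fps_mult less GJ cXJJ XJJ J JJ conv evJ)
  moreover have "1 - z \<noteq> 0" using z by auto
  moreover have "u = C * z / w + w * (u / w - C * (z * (1 / w * (1 / w))))" if "w \<noteq> 0" for u C w :: complex
    using that by (simp add: field_simps)
  ultimately show "eval_fps G z = of_real c * z / (1 - z) + (1 - z) * eval_fps H z"
    by metis
qed

section \<open>The Erdos-Fuchs argument for powers\<close>

text \<open>The lower and the upper bound on the circle with \<open>r\<^sup>2 = 1 - 1 / n\<close>. There the pole of \<open>G = g ^ s\<close> makes
\<open>G (r\<^sup>2)\<close> about \<open>c * n\<close>, and a bound of order \<open>k powr \<beta>\<close> for the error makes the mean square of \<open>H\<close> of order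
\<open>n powr (1 + 2 * \<beta>)\<close>. The condition \<open>2 * N \<le> n\<close> keeps \<open>r ^ (2 * N)\<close> away from zero.\<close>

lemma erdos_fuchs_inequality:
  fixes g :: "complex fps" and R E :: "nat \<Rightarrow> real" and c K \<beta> \<mu> :: real and n N s :: nat
  assumes conv: "fps_conv_radius g \<ge> 1" and nat: "\<And>n. fps_nth g n \<in> \<nat>" and s: "s \<ge> 2"
    and R: "\<And>n. fps_nth (g ^ s) n = of_real (R n)"
    and E: "\<And>n. (\<Sum>j\<le>n. R j) = c * n + E n"
    and bound: "\<And>n. \<bar>E n\<bar> \<le> K * (real n + 1) powr \<beta>" and \<beta>: "0 \<le> \<beta>" "\<beta> \<le> 1 / 2"
    and c: "c > 0" and N: "N \<ge> 1" "2 * N \<le> n" and \<mu>: "\<mu> > 0"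
  shows "N * sqrt (c * (real n - 1) - 2 * K * n powr \<beta>) / 2 ^ s
           \<le> 2 * c * (real N)\<^sup>2 * ln n + \<mu> * N + 2 * K\<^sup>2 * n powr (1 + 2 * \<beta>) / \<mu>"
proof -
  define x where "x = 1 - 1 / real n"
  define r where "r = sqrt x"
  have n: "n \<ge> 2" using N by simp
  have x: "1 / 2 \<le> x" "x < 1" using n by (auto simp: x_def field_simps)
  have r: "0 < r" "r < 1" "r\<^sup>2 = x" using x by (auto simp: r_def)
  have K: "K \<ge> 0" using bound[of 0] by simp
  have conv_pow: "fps_conv_radius (g ^ s) \<ge> 1"
    using conv fps_conv_radius_power order_trans by blast
  obtain H where H: "\<And>n. fps_nth H n = of_real (E n)" "fps_conv_radius H \<ge> 1"
    "\<And>z. cmod z < 1 \<Longrightarrow> eval_fps (g ^ s) z = of_real c * z / (1 - z) + (1 - z) * eval_fps H z"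
    using error_fps[OF conv_pow R E] by blast
  have xN: "x ^ N \<ge> 1 / 2"
  proof -
    have "1 + real N * (- 1 / n) \<le> (1 + (- 1 / n)) ^ N"
      using n by (intro Bernoulli_inequality) (simp add: field_simps)
    moreover have "1 / 2 \<le> 1 + real N * (- 1 / n)" using N n by (simp add: field_simps)
    ultimately show ?thesis by (simp add: x_def)
  qed
  have norm_x: "cmod (of_real x) < 1" using x by simp
  have Hx: "cmod (eval_fps H (of_real x)) \<le> 2 * K * n powr (1 + \<beta>)"
  proof -
    have s1: "summable (\<lambda>k. (real k + 1) powr \<beta> * x ^ k)"
      and s2: "(\<Sum>k. (real k + 1) powr \<beta> * x ^ k) \<le> 2 * n powr (1 + \<beta>)"
      by (rule suminf_powr_le; use n \<beta> in \<open>simp add: x_def\<close>)+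
    have "cmod (eval_fps H (of_real x)) \<le> (\<Sum>k. K * ((real k + 1) powr \<beta> * x ^ k))"
      unfolding eval_fps_def
    proof (rule norm_suminf_le)
      fix k
      show "cmod (fps_nth H k * of_real x ^ k) \<le> K * ((real k + 1) powr \<beta> * x ^ k)"
        using mult_right_mono[OF bound[of k], of "x ^ k"] x by (simp add: H norm_mult norm_power mult_ac)
    qed (intro summable_mult s1)
    also have "\<dots> = K * (\<Sum>k. (real k + 1) powr \<beta> * x ^ k)" by (rule suminf_mult[OF s1])
    also have "\<dots> \<le> K * (2 * n powr (1 + \<beta>))" using K s2 by (intro mult_left_mono)
    finally show ?thesis by simp
  qed
  have Hmean: "circle_mean r (\<lambda>z. (cmod (eval_fps H z))\<^sup>2) \<le> 2 * K\<^sup>2 * n powr (1 + 2 * \<beta>)"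
  proof -
    have s1: "summable (\<lambda>k. (real k + 1) powr (2 * \<beta>) * x ^ k)"
      and s2: "(\<Sum>k. (real k + 1) powr (2 * \<beta>) * x ^ k) \<le> 2 * n powr (1 + 2 * \<beta>)"
      by (rule suminf_powr_le; use n \<beta> in \<open>simp add: x_def\<close>)+
    have "circle_mean r (\<lambda>z. (cmod (eval_fps H z))\<^sup>2) \<le> K\<^sup>2 * (\<Sum>k. (real k + 1) powr (2 * \<beta>) * x ^ k)"
    proof (rule sums_le)
      show "(\<lambda>k. (cmod (fps_nth H k))\<^sup>2 * r ^ (2 * k)) sums circle_mean r (\<lambda>z. (cmod (eval_fps H z))\<^sup>2)"
        by (rule parseval_circle_mean) (use r less_conv_radius[OF H(2)] in auto)
      show "(\<lambda>k. K\<^sup>2 * ((real k + 1) powr (2 * \<beta>) * x ^ k)) sums (K\<^sup>2 * (\<Sum>k. (real k + 1) powr (2 * \<beta>) * x ^ k))"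
        by (intro sums_mult summable_sums s1)
      fix k
      have rk: "r ^ (2 * k) = x ^ k" unfolding power_mult r(3) ..
      have "(E k)\<^sup>2 \<le> (K * (real k + 1) powr \<beta>)\<^sup>2"
        using power_mono[OF bound[of k], of 2] by simp
      also have "\<dots> = K\<^sup>2 * (real k + 1) powr (2 * \<beta>)"
        by (simp add: power_mult_distrib power2_eq_square flip: powr_add)
      finally have "(E k)\<^sup>2 * x ^ k \<le> K\<^sup>2 * (real k + 1) powr (2 * \<beta>) * x ^ k"
        using x by (intro mult_right_mono) auto
      then show "(cmod (fps_nth H k))\<^sup>2 * r ^ (2 * k) \<le> K\<^sup>2 * ((real k + 1) powr (2 * \<beta>) * x ^ k)"
        unfolding rk by (simp add: H mult_ac)
    qed
    also have "\<dots> \<le> K\<^sup>2 * (2 * n powr (1 + 2 * \<beta>))" using s2 by (intro mult_left_mono) auto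
    finally show ?thesis by simp
  qed
  have Gx: "c * (real n - 1) - 2 * K * n powr \<beta> \<le> Re (eval_fps (g ^ s) (of_real x))"
  proof -
    have "eval_fps (g ^ s) (of_real x) = of_real (c * (x / (1 - x))) + of_real (1 - x) * eval_fps H (of_real x)"
      unfolding H(3)[OF norm_x] by simp
    moreover have "x / (1 - x) = real n - 1" "1 - x = 1 / n" using n by (auto simp: x_def field_simps)
    ultimately have "Re (eval_fps (g ^ s) (of_real x)) = c * (real n - 1) + (1 / n) * Re (eval_fps H (of_real x))"
      by simp
    moreover have "(1 / n) * (- (2 * K * n powr (1 + \<beta>))) \<le> (1 / n) * Re (eval_fps H (of_real x))"
      using Hx abs_Re_le_cmod[of "eval_fps H (of_real x)"] by (intro mult_left_mono) auto
    moreover have "(1 / n) * (2 * K * n powr (1 + \<beta>)) = 2 * K * n powr \<beta>"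
      using n by (simp add: powr_add)
    ultimately show ?thesis by simp
  qed
  have lnx: "- ln (1 - x) / x \<le> 2 * ln n"
  proof -
    have "- ln (1 - x) = ln n" using n by (simp add: x_def ln_div)
    moreover have "ln n / x \<le> ln n / (1 / 2)"
      using x n by (intro divide_left_mono) auto
    ultimately show ?thesis by simp
  qed
  have "N * sqrt (c * (real n - 1) - 2 * K * n powr \<beta>) / 2 ^ s
          \<le> N * sqrt (Re (eval_fps (g ^ s) (of_real (r\<^sup>2)))) / 2 ^ s"
    using Gx by (intro divide_right_mono mult_left_mono real_sqrt_le_mono) (auto simp: r(3))
  also have "\<dots> \<le> circle_mean r (\<lambda>z. (cmod (eval_fps (geom_fps N) z))\<^sup>2 * cmod (eval_fps (g ^ s) z))"
    by (rule circle_mean_power_lower[OF conv nat]) (use r s xN in auto)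
  also have "\<dots> \<le> c * (real N)\<^sup>2 * (- ln (1 - r\<^sup>2) / r\<^sup>2) + \<mu> * N
        + circle_mean r (\<lambda>z. (cmod (eval_fps H z))\<^sup>2) / \<mu>"
    by (rule circle_mean_upper[OF conv_pow H(2) r(1,2) \<mu> _ H(3)]) (use c in auto)
  also have "\<dots> \<le> c * (real N)\<^sup>2 * (2 * ln n) + \<mu> * N + 2 * K\<^sup>2 * n powr (1 + 2 * \<beta>) / \<mu>"
    unfolding r(3) using lnx Hmean \<mu> c by (intro add_mono mult_left_mono divide_right_mono) auto
  finally show ?thesis by (simp add: mult_ac)
qed

text \<open>The inequality above, divided by \<open>N\<close>, for \<open>N\<close> about \<open>n powr (1/2 - \<delta>)\<close> and \<open>\<mu> = n powr (1/2 - \<delta>/2)\<close>. The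
right-hand side below has the order \<open>n powr (1/2)\<close>, and every term on the left is smaller by a power of \<open>n\<close>.\<close>

lemma erdos_fuchs_error_terms_smaller:
  fixes c C K \<delta> :: real
  assumes "c > 0" "C > 0" "K > 0" "0 < \<delta>" "\<delta> < 1/4"
  shows "eventually (\<lambda>n::nat. 2 * c * n powr (1/2 - \<delta>) * ln n + n powr (1/2 - \<delta>/2)
     + 4 * K\<^sup>2 * n powr (1/2 - \<delta>/2) < sqrt (c * (real n - 1) - 2 * K * n powr (1/4 - \<delta>)) / C) at_top"
  using assms by real_asymp

text \<open>The value of \<open>N\<close> is forced up to small powers of \<open>n\<close>: the term from the pole is harmless only if \<open>N\<close> is
below \<open>n powr (1/2)\<close>, and the term from the error only if \<open>N\<close> is above \<open>n powr (1/2 - 2 * \<delta>)\<close>. The choice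
\<open>n powr (1/2 - \<delta>)\<close> lies in the middle.\<close>

theorem erdos_fuchs_power:
  fixes g :: "complex fps" and R :: "nat \<Rightarrow> real" and c K \<delta> :: real and s :: nat
  assumes conv: "fps_conv_radius g \<ge> 1" and nat: "\<And>n. fps_nth g n \<in> \<nat>" and s: "s \<ge> 2"
    and R: "\<And>n. fps_nth (g ^ s) n = of_real (R n)"
    and c: "c > 0" and \<delta>: "0 < \<delta>" "\<delta> < 1 / 4"
    and bound: "\<And>n. \<bar>(\<Sum>j\<le>n. R j) - c * n\<bar> \<le> K * (real n + 1) powr (1 / 4 - \<delta>)"
  shows False
proof -
  define E where "E = (\<lambda>n. (\<Sum>j\<le>n. R j) - c * real n)"
  \<comment> \<open>A positive constant, as the asymptotic comparison needs the sign.\<close>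
  define L where "L = K + 1"
  have "K \<ge> 0" using bound[of 0] by simp
  then have L: "L > 0" by (simp add: L_def)
  have E: "(\<Sum>j\<le>n. R j) = c * n + E n" for n by (simp add: E_def)
  have bE: "\<bar>E n\<bar> \<le> L * (real n + 1) powr (1 / 4 - \<delta>)" for n
    using order_trans[OF bound[of n], of "L * (real n + 1) powr (1 / 4 - \<delta>)"] by (simp add: E_def L_def mult_right_mono)
  have "eventually (\<lambda>n::nat. 2 \<le> n powr (1/2 - \<delta>)) at_top"
    "eventually (\<lambda>n::nat. 2 * n powr (1/2 - \<delta>) \<le> n) at_top"
    using \<delta> by real_asymp+
  moreover have "eventually (\<lambda>n::nat. 2 * c * n powr (1/2 - \<delta>) * ln n + n powr (1/2 - \<delta>/2)
     + 4 * L\<^sup>2 * n powr (1/2 - \<delta>/2) < sqrt (c * (real n - 1) - 2 * L * n powr (1/4 - \<delta>)) / 2 ^ s) at_top"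
    by (rule erdos_fuchs_error_terms_smaller) (use c L \<delta> in auto)
  ultimately have "eventually (\<lambda>n::nat. False) at_top"
    using eventually_gt_at_top[of 0]
  proof eventually_elim
    case (elim n)
    define y where "y = n powr (1/2 - \<delta>)"
    define N where "N = nat \<lfloor>y\<rfloor>"
    have y: "2 \<le> y" "2 * y \<le> n" using elim by (auto simp: y_def)
    have N: "real N \<le> y" "y / 2 \<le> real N" unfolding N_def using y by linarith+
    have N1: "N \<ge> 1" "2 * N \<le> n" using N y by linarith+
    define \<mu> where "\<mu> = n powr (1/2 - \<delta>/2)"
    have \<mu>: "\<mu> > 0" using elim by (simp add: \<mu>_def)
    have ln: "ln n \<ge> 0" using elim by simp
    have "N * sqrt (c * (real n - 1) - 2 * L * n powr (1/4 - \<delta>)) / 2 ^ s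
           \<le> 2 * c * (real N)\<^sup>2 * ln n + \<mu> * N + 2 * L\<^sup>2 * n powr (1 + 2 * (1/4 - \<delta>)) / \<mu>"
      by (rule erdos_fuchs_inequality[OF conv nat s R E bE _ _ c N1 \<mu>]) (use \<delta> in auto)
    then have "sqrt (c * (real n - 1) - 2 * L * n powr (1/4 - \<delta>)) / 2 ^ s
           \<le> (2 * c * (real N)\<^sup>2 * ln n + \<mu> * N + 2 * L\<^sup>2 * n powr (1 + 2 * (1/4 - \<delta>)) / \<mu>) / N"
      using N1 by (simp add: field_simps)
    also have "\<dots> = 2 * c * N * ln n + \<mu> + 2 * L\<^sup>2 * n powr (1 + 2 * (1/4 - \<delta>)) / (\<mu> * N)"
      using N1 by (simp add: add_divide_distrib power2_eq_square)
    also have "\<dots> \<le> 2 * c * y * ln n + \<mu> + 2 * L\<^sup>2 * n powr (1 + 2 * (1/4 - \<delta>)) / (\<mu> * (y / 2))"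
      using N N1 y \<mu> c ln
      by (intro add_mono divide_left_mono mult_left_mono mult_right_mono order_refl mult_pos_pos) auto
    also have "n powr (1 + 2 * (1/4 - \<delta>)) = \<mu> * \<mu> * y"
      unfolding \<mu>_def y_def by (simp flip: powr_add)
    also have "2 * L\<^sup>2 * (\<mu> * \<mu> * y) / (\<mu> * (y / 2)) = 4 * L\<^sup>2 * \<mu>"
      using \<mu> y by (simp add: field_simps)
    finally show False using elim by (simp add: \<mu>_def y_def)
  qed
  then show False by simp
qed

section \<open>The generating function of the representation function\<close>

text \<open>This is \<open>f(z ^ k)\<close>, where \<open>f\<close> is the generating function of \<open>A\<close>. For \<open>k > 0\<close> every exponent comes from one
element of \<open>A\<close>, so that the coefficients are \<open>0\<close> and \<open>1\<close>.\<close>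

definition dilated_fps :: "nat set \<Rightarrow> nat \<Rightarrow> complex fps" where
  "dilated_fps A k = Abs_fps (\<lambda>n. if n \<in> (\<lambda>a. k * a) ` A then 1 else 0)"

text \<open>Sorting the solutions by the value \<open>v\<close> of the new variable; this is the recursion that the coefficients
of the product of the dilated series satisfy.\<close>

lemma card_weighted_solutions_insert:
  fixes w :: "'i \<Rightarrow> nat" and A :: "nat set"
  assumes "finite I" "i \<notin> I" "\<And>j. j \<in> insert i I \<Longrightarrow> w j > 0"
  shows "card {a \<in> insert i I \<rightarrow>\<^sub>E A. n = (\<Sum>j\<in>insert i I. w j * a j)}
    = (\<Sum>v | v \<in> A \<and> w i * v \<le> n. card {a \<in> I \<rightarrow>\<^sub>E A. n - w i * v = (\<Sum>j\<in>I. w j * a j)})"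
proof -
  define Sol where "Sol = (\<lambda>n. {a \<in> I \<rightarrow>\<^sub>E A. n = (\<Sum>j\<in>I. w j * a j)})"
  define V where "V = {v. v \<in> A \<and> w i * v \<le> n}"
  have finSol: "finite (Sol n)" for n
  proof (rule finite_subset)
    show "finite (I \<rightarrow>\<^sub>E {..n})" using assms(1) by (intro finite_PiE) auto
    show "Sol n \<subseteq> I \<rightarrow>\<^sub>E {..n}"
    proof
      fix a assume a: "a \<in> Sol n"
      have "a j \<le> n" if "j \<in> I" for j
      proof -
        have "a j \<le> w j * a j" using assms(3)[of j] that by simp
        also have "\<dots> \<le> (\<Sum>j\<in>I. w j * a j)" using that assms(1) by (intro member_le_sum) auto
        finally show ?thesis using a by (simp add: Sol_def)
      qed
      then show "a \<in> I \<rightarrow>\<^sub>E {..n}" using a by (auto simp: Sol_def PiE_iff)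
    qed
  qed
  have finV: "finite V"
  proof (rule finite_subset)
    show "V \<subseteq> {..n}"
    proof
      fix v assume "v \<in> V"
      then have "w i * v \<le> n" by (simp add: V_def)
      moreover have "v \<le> w i * v" using assms(3)[of i] by simp
      ultimately show "v \<in> {..n}" by (simp only: atMost_iff)
    qed
  qed simp
  have sum_upd: "(\<Sum>j\<in>I. w j * (if j = i then v else a j)) = (\<Sum>j\<in>I. w j * a j)" for v a
    using assms(2) by (intro sum.cong) auto
  have "bij_betw (\<lambda>(v, a). a(i := v)) (SIGMA v:V. Sol (n - w i * v))
          {a \<in> insert i I \<rightarrow>\<^sub>E A. n = (\<Sum>j\<in>insert i I. w j * a j)}"
  proof (rule bij_betw_byWitness[where f' = "\<lambda>a. (a i, a(i := undefined))"])
    show "\<forall>p\<in>SIGMA v:V. Sol (n - w i * v).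
            ((case p of (v, a) \<Rightarrow> a(i := v)) i, (case p of (v, a) \<Rightarrow> a(i := v))(i := undefined)) = p"
      using assms(2) by (auto simp: Sol_def PiE_iff extensional_def fun_eq_iff)
    show "\<forall>a\<in>{a \<in> insert i I \<rightarrow>\<^sub>E A. n = (\<Sum>j\<in>insert i I. w j * a j)}.
            (case (a i, a(i := undefined)) of (v, a) \<Rightarrow> a(i := v)) = a"
      by simp
    show "(\<lambda>(v, a). a(i := v)) ` (SIGMA v:V. Sol (n - w i * v))
            \<subseteq> {a \<in> insert i I \<rightarrow>\<^sub>E A. n = (\<Sum>j\<in>insert i I. w j * a j)}"
      using assms(1,2) by (auto simp: Sol_def V_def PiE_iff extensional_def sum_upd)
    show "(\<lambda>a. (a i, a(i := undefined))) ` {a \<in> insert i I \<rightarrow>\<^sub>E A. n = (\<Sum>j\<in>insert i I. w j * a j)}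
            \<subseteq> (SIGMA v:V. Sol (n - w i * v))"
      using assms(1,2) by (auto simp: Sol_def V_def PiE_iff extensional_def sum_upd)
  qed
  from bij_betw_same_card[OF this, symmetric]
  have "card {a \<in> insert i I \<rightarrow>\<^sub>E A. n = (\<Sum>j\<in>insert i I. w j * a j)}
      = card (SIGMA v:V. Sol (n - w i * v))" .
  also have "\<dots> = (\<Sum>v\<in>V. card (Sol (n - w i * v)))"
    using finV finSol by (intro card_SigmaI) auto
  finally show ?thesis by (simp add: V_def Sol_def)
qed

lemma fps_nth_prod_dilated_fps:
  fixes w :: "'i \<Rightarrow> nat" and A :: "nat set"
  assumes "finite I" "\<And>i. i \<in> I \<Longrightarrow> w i > 0"
  shows "fps_nth (\<Prod>i\<in>I. dilated_fps A (w i)) n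
           = of_nat (card {a \<in> I \<rightarrow>\<^sub>E A. n = (\<Sum>i\<in>I. w i * a i)})"
  using assms
proof (induction I arbitrary: n rule: finite_induct)
  case empty
  have "{a. a = (\<lambda>x. undefined :: nat) \<and> n = 0} = (if n = 0 then {\<lambda>x. undefined} else {})" by auto
  then show ?case by simp
next
  case (insert i I)
  define C where "C = (\<lambda>n. card {a \<in> I \<rightarrow>\<^sub>E A. n = (\<Sum>j\<in>I. w j * a j)})"
  have wi: "w i > 0" using insert.prems by simp
  have "fps_nth (\<Prod>i\<in>insert i I. dilated_fps A (w i)) n
      = (\<Sum>j=0..n. (if j \<in> (\<lambda>a. w i * a) ` A then of_nat (C (n - j)) else 0))"
  proof -
    have "fps_nth (\<Prod>i\<in>insert i I. dilated_fps A (w i)) n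
        = (\<Sum>j=0..n. fps_nth (dilated_fps A (w i)) j * of_nat (C (n - j)))"
      using insert by (simp add: fps_mult_nth C_def)
    also have "\<dots> = (\<Sum>j=0..n. (if j \<in> (\<lambda>a. w i * a) ` A then of_nat (C (n - j)) else 0))"
      by (intro sum.cong) (auto simp: dilated_fps_def)
    finally show ?thesis .
  qed
  also have "\<dots> = (\<Sum>j | j \<in> {0..n} \<and> j \<in> (\<lambda>a. w i * a) ` A. of_nat (C (n - j)))"
    by (simp only: sum.inter_filter[OF finite_atLeastAtMost])
  also have "{j. j \<in> {0..n} \<and> j \<in> (\<lambda>a. w i * a) ` A} = (\<lambda>a. w i * a) ` {v. v \<in> A \<and> w i * v \<le> n}"
    by auto
  also have "(\<Sum>j\<in>\<dots>. of_nat (C (n - j)) :: complex)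
      = of_nat (\<Sum>v | v \<in> A \<and> w i * v \<le> n. C (n - w i * v))"
    using wi by (subst sum.reindex) (auto simp: inj_on_def)
  also have "(\<Sum>v | v \<in> A \<and> w i * v \<le> n. C (n - w i * v))
      = card {a \<in> insert i I \<rightarrow>\<^sub>E A. n = (\<Sum>j\<in>insert i I. w j * a j)}"
    unfolding C_def by (rule card_weighted_solutions_insert[symmetric]) (use insert in auto)
  finally show ?case .
qed

lemma config_index_conv: "config_index m = (\<Union>p\<in>m. {fst p} \<times> {1..snd p})"
  by (auto simp: config_index_def)

lemma config_index_disjoint:
  assumes "configuration m" "p \<in> m" "q \<in> m" "p \<noteq> q"
  shows "({fst p} \<times> {1..snd p}) \<inter> ({fst q} \<times> {1..snd q}) = {}"
  using assms by (auto simp: configuration_def inj_on_def)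

text \<open>The variables with the same \<open>k\<close> form a block of the index set, and each of them contributes the same
factor to the product, whence the exponents. The blocks are disjoint because the \<open>k\<close> are distinct.\<close>

lemma rep_fun_eq_fps_nth:
  assumes m: "configuration m"
  shows "fps_nth (\<Prod>p\<in>m. dilated_fps A (fst p) ^ snd p) n = of_nat (rep_fun m n A)"
proof -
  have fin: "finite m" using m by (simp add: configuration_def)
  have block_prod: "(\<Prod>i\<in>{k} \<times> {1..l}. dilated_fps A (fst i)) = dilated_fps A k ^ l" for k l :: nat
  proof -
    have "(\<Prod>i\<in>{k} \<times> {1..l}. dilated_fps A (fst i)) = (\<Prod>i\<in>{k} \<times> {1..l}. dilated_fps A k)"
      by (intro prod.cong) auto
    then show ?thesis by (simp add: card_cartesian_product)
  qed
  have block_sum: "(\<Sum>i\<in>{k} \<times> {1..l}. fst i * a i) = k * (\<Sum>j=1..l. a (k, j))"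
    for k l :: nat and a :: "nat \<times> nat \<Rightarrow> nat"
  proof -
    have "(\<Sum>i\<in>{k} \<times> {1..l}. fst i * a i) = (\<Sum>j=1..l. k * a (k, j))"
      by (rule sum.reindex_bij_witness[of _ "\<lambda>j. (k, j)" snd]) auto
    then show ?thesis by (simp add: sum_distrib_left)
  qed
  have disj: "\<forall>p\<in>m. \<forall>q\<in>m. p \<noteq> q \<longrightarrow> ({fst p} \<times> {1..snd p}) \<inter> ({fst q} \<times> {1..snd q}) = {}"
    using config_index_disjoint[OF m] by blast
  have "(\<Prod>i\<in>config_index m. dilated_fps A (fst i)) = (\<Prod>p\<in>m. dilated_fps A (fst p) ^ snd p)"
    unfolding config_index_conv by (subst prod.UNION_disjoint) (use fin disj block_prod in auto)
  moreover have "(\<Sum>i\<in>config_index m. fst i * a i) = (\<Sum>(k, l)\<in>m. k * (\<Sum>j=1..l. a (k, j)))" for a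
    unfolding config_index_conv
    by (subst sum.UNION_disjoint) (use fin disj block_sum in \<open>auto simp: split_beta\<close>)
  moreover have "finite (config_index m)" "\<And>i. i \<in> config_index m \<Longrightarrow> fst i > 0"
    using m by (auto simp: config_index_conv configuration_def)
  ultimately show ?thesis
    using fps_nth_prod_dilated_fps[of "config_index m" fst A n] by (simp add: rep_fun_def solutions_def)
qed

lemma Nats_conv_radius_prod_power:
  fixes f :: "'i \<Rightarrow> complex fps"
  assumes "\<And>i n. fps_nth (f i) n \<in> \<nat>" "\<And>i. fps_conv_radius (f i) \<ge> 1"
  shows "fps_nth (\<Prod>i\<in>I. f i ^ e i) n \<in> \<nat>" "fps_conv_radius (\<Prod>i\<in>I. f i ^ e i) \<ge> 1"
proof -
  have pow: "fps_nth (f i ^ e) n \<in> \<nat>" for i e n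
    by (induction e arbitrary: n) (auto intro: Nats_fps_mult assms)
  show "fps_nth (\<Prod>i\<in>I. f i ^ e i) n \<in> \<nat>"
    by (induction I arbitrary: n rule: infinite_finite_induct) (auto intro: Nats_fps_mult pow)
  show "fps_conv_radius (\<Prod>i\<in>I. f i ^ e i) \<ge> 1"
  proof (induction I rule: infinite_finite_induct)
    case (insert i I)
    have "fps_conv_radius (f i ^ e i) \<ge> 1"
      using assms(2) fps_conv_radius_power order_trans by blast
    then show ?case
      using insert by (auto intro!: order_trans[OF _ fps_conv_radius_mult])
  qed auto
qed

section \<open>The theorem\<close>

text \<open>With a nonnegative exponent and \<open>n + 1\<close> in place of \<open>n\<close> the comparison function is at least \<open>1\<close>, so the
finitely many exceptions can be absorbed into the constant.\<close>

lemma bigo_powr_uniform_bound: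
  fixes T :: "nat \<Rightarrow> real" and \<alpha> \<beta> :: real
  assumes "T \<in> O(\<lambda>n. real n powr \<alpha>)" "\<alpha> \<le> \<beta>" "0 \<le> \<beta>"
  obtains K where "\<And>n. \<bar>T n\<bar> \<le> K * (real n + 1) powr \<beta>"
proof -
  obtain c where c: "c > 0" "eventually (\<lambda>n. norm (T n) \<le> c * norm (real n powr \<alpha>)) at_top"
    using assms(1) by (elim landau_o.bigE)
  then obtain n0 where n0: "\<And>n. n \<ge> n0 \<Longrightarrow> \<bar>T n\<bar> \<le> c * real n powr \<alpha>"
    by (auto simp: eventually_at_top_linorder)
  show ?thesis
  proof
    fix n
    have one: "1 \<le> (real n + 1) powr \<beta>" using assms by (intro ge_one_powr_ge_zero) auto
    have "\<bar>T n\<bar> \<le> c * (real n + 1) powr \<beta> + (\<Sum>i\<le>n0. \<bar>T i\<bar>)"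
    proof (cases "n > n0")
      case True
      then have "real n powr \<alpha> \<le> real n powr \<beta>" using assms by (intro powr_mono) auto
      also have "\<dots> \<le> (real n + 1) powr \<beta>" using assms by (intro powr_mono2) auto
      finally have "c * real n powr \<alpha> \<le> c * (real n + 1) powr \<beta>" using c by simp
      then have "\<bar>T n\<bar> \<le> c * (real n + 1) powr \<beta>" using n0[of n] True by simp
      then show ?thesis by (simp add: add_increasing2 sum_nonneg)
    next
      case False
      then have "\<bar>T n\<bar> \<le> (\<Sum>i\<le>n0. \<bar>T i\<bar>)" by (intro member_le_sum) auto
      then show ?thesis using c by (simp add: add_increasing)
    qed
    also have "(\<Sum>i\<le>n0. \<bar>T i\<bar>) \<le> (\<Sum>i\<le>n0. \<bar>T i\<bar>) * (real n + 1) powr \<beta>"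
      using mult_left_mono[OF one, of "\<Sum>i\<le>n0. \<bar>T i\<bar>"] by (simp add: sum_nonneg)
    finally show "\<bar>T n\<bar> \<le> (c + (\<Sum>i\<le>n0. \<bar>T i\<bar>)) * (real n + 1) powr \<beta>"
      by (simp add: algebra_simps)
  qed
qed

theorem theorem2:
  fixes A :: "nat set" and m :: "(nat \<times> nat) set" and \<epsilon> c :: real
  assumes "infinite A" and "\<forall>a\<in>A. 0 < a"
    and "configuration m" and "config_degree m > 1"
    and "\<epsilon> > 0" and "c > 0"
  shows "(\<lambda>n::nat. \<Sum>j=1..n. (real (rep_fun m j A) - c)) \<notin> O(\<lambda>n. real n powr (1/4 - \<epsilon>))"
proof
  assume bigo: "(\<lambda>n::nat. \<Sum>j=1..n. (real (rep_fun m j A) - c)) \<in> O(\<lambda>n. real n powr (1/4 - \<epsilon>))"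
  define s where "s = config_degree m"
  \<comment> \<open>A larger \<open>\<epsilon>\<close> is a stronger hypothesis; below \<open>1/4\<close> the exponent of the error stays positive.\<close>
  define \<delta> where "\<delta> = min \<epsilon> (1 / 8)"
  have \<delta>: "0 < \<delta>" "\<delta> < 1 / 4" "\<delta> \<le> \<epsilon>" using assms by (auto simp: \<delta>_def)
  \<comment> \<open>The degree divides all multiplicities, so the generating function is an \<open>s\<close>-th power of a series with natural coefficients.\<close>
  define g where "g = (\<Prod>p\<in>m. dilated_fps A (fst p) ^ (snd p div s))"
  define R where "R = (\<lambda>n. real (rep_fun m n A))"
  have dil: "fps_nth (dilated_fps A k) n \<in> \<nat>" "fps_conv_radius (dilated_fps A k) \<ge> 1" for k n
    by (auto simp: dilated_fps_def intro: conv_radius_ge_1_bounded)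
  have g: "fps_nth g n \<in> \<nat>" "fps_conv_radius g \<ge> 1" for n
    unfolding g_def by (intro Nats_conv_radius_prod_power dil)+
  have "g ^ s = (\<Prod>p\<in>m. dilated_fps A (fst p) ^ snd p)"
    unfolding g_def prod_power_distrib
  proof (intro prod.cong refl)
    fix p assume "p \<in> m"
    then have "s dvd snd p" by (auto simp: s_def config_degree_def intro: Gcd_dvd)
    then show "(dilated_fps A (fst p) ^ (snd p div s)) ^ s = dilated_fps A (fst p) ^ snd p"
      by (simp flip: power_mult)
  qed
  then have gs: "fps_nth (g ^ s) n = of_real (R n)" for n
    by (simp add: rep_fun_eq_fps_nth[OF assms(3)] R_def)
  obtain K where K: "\<And>n. \<bar>\<Sum>j=1..n. (R j - c)\<bar> \<le> K * (real n + 1) powr (1 / 4 - \<delta>)"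
    using bigo_powr_uniform_bound[OF bigo, of "1 / 4 - \<delta>"] \<delta> unfolding R_def by auto
  have bound: "\<bar>(\<Sum>j\<le>n. R j) - c * n\<bar> \<le> (R 0 + K) * (real n + 1) powr (1 / 4 - \<delta>)" for n
  proof -
    have one: "1 \<le> (real n + 1) powr (1 / 4 - \<delta>)" using \<delta> by (intro ge_one_powr_ge_zero) auto
    have "(\<Sum>j\<le>n. R j) = R 0 + (\<Sum>j=1..n. R j)"
      by (simp add: atMost_atLeast0 sum.atLeast_Suc_atMost)
    then have "(\<Sum>j\<le>n. R j) - c * n = R 0 + (\<Sum>j=1..n. (R j - c))"
      by (simp add: sum_subtractf)
    then have "\<bar>(\<Sum>j\<le>n. R j) - c * n\<bar> \<le> R 0 + K * (real n + 1) powr (1 / 4 - \<delta>)"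
      using K[of n] abs_triangle_ineq[of "R 0" "\<Sum>j=1..n. (R j - c)"] by (simp add: R_def)
    also have "R 0 \<le> R 0 * (real n + 1) powr (1 / 4 - \<delta>)"
      using mult_left_mono[OF one, of "R 0"] by (simp add: R_def)
    finally show ?thesis by (simp add: algebra_simps)
  qed
  show False
    by (rule erdos_fuchs_power[OF g(2,1) _ gs assms(6) \<delta>(1,2) bound]) (use assms(4) in \<open>simp add: s_def\<close>)
qed

end
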